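(* Let $\{a_N\}_{N=0}^\infty \subset \mathbb{Z}^+$ be an increasing sequence of positive integers. Let $\{k(N)\}_{N\ge 1}$ be a sequence of non-negative real numbers such that $\frac{k(N)\,\sigma_{a_N}}{a_N} \to 0$ as $N\to\infty$ and $\sum_{N=1}^\infty \frac{1}{k(N)^2} < \infty$. Suppose $\mu_{a_N} \to \mu$. Then, for all $u,v \in L^2[0,1]$, almost surely $\langle W_{a_N}X_{a_N}W_{a_N}^*(u), v\rangle \rightarrow \mu \langle V(u), v\rangle$ as $N\to\infty$.
   Context: For each $N\ge 1$, $X_N=\frac1N(X^N_{i,j})_{i,j=1}^N$ is an $N\times N$ random lower triangular matrix: the entries $X^N_{i,j}$ with $1\le j\le i\le N$ are iid (scalar, possibly complex) random variables with finite mean $\mu_N$ and finite variance $\sigma_N^2=E|X^N_{i,j}-\mu_N|^2$ (with $\sigma_N\ge 0$), and $X^N_{i,j}=0$ for $j>i$. All the matrices $X_N$ are defined on a common probability space; nothing is assumed on the joint law for different $N$. $V$ is the Volterra operator on $L^2[0,1]$: $V(f)(x)=\int_0^x f(t)\,dt$. For $1\le i\le N$ let $e_i^N=\sqrt N\,\mathbf 1_{[(i-1)/N,\,i/N]}\in L^2[0,1]$. $W_N:\mathbb{C}^N\to L^2[0,1]$ is the isometry $W_N(c_1,\dots,c_N)=\sum_{i=1}^N c_ie_i^N$; its adjoint is $W_N^*(f)=(\langle f,e_1^N\rangle,\dots,\langle f,e_N^N\rangle)$. The inner product $\langle\cdot,\cdot\rangle$ is linear in the first variable. "Increasing" means strictly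 increasing. The convention $1/0=+\infty$ is used, so the summability condition forces $k(N)>0$ for all $N\ge1$. *)

theory Defs
  imports "HOL-Probability.Probability" "Jordan_Normal_Form.Matrix"
begin

text \<open>
  Elements of \<open>L\<^sup>2[0,1]\<close> are represented by square-integrable functions. All operations below
  depend on their arguments only up to equality almost everywhere on \<open>[0,1]\<close>.
\<close>

definition L2_01 :: "(real \<Rightarrow> complex) set" where
  "L2_01 = {f \<in> borel_measurable (lebesgue_on {0..1}).
              integrable (lebesgue_on {0..1}) (\<lambda>x. (norm (f x))\<^sup>2)}"

definition L2_inner :: "(real \<Rightarrow> complex) \<Rightarrow> (real \<Rightarrow> complex) \<Rightarrow> complex" where
  "L2_inner f g = integral\<^sup>L (lebesgue_on {0..1}) (\<lambda>x. f x * cnj (g x))"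

definition volterra :: "(real \<Rightarrow> complex) \<Rightarrow> real \<Rightarrow> complex" where
  "volterra f x = integral\<^sup>L (lebesgue_on {0..x}) f"

definition step :: "nat \<Rightarrow> nat \<Rightarrow> real \<Rightarrow> complex" where
  "step N i x = of_real (sqrt (real N)) * indicator {(real i - 1) / real N .. real i / real N} x"

text \<open>
  Vectors and matrices of the library are indexed from \<open>0\<close>, whereas \<^const>\<open>step\<close> \<open>N i\<close> and the
  entries \<open>X N i j\<close> are indexed by \<open>1, \<dots>, N\<close>; hence the successors below.
\<close>

definition W :: "nat \<Rightarrow> complex Matrix.vec \<Rightarrow> real \<Rightarrow> complex" where
  "W N c x = (\<Sum>i<N. vec_index c i * step N (Suc i) x)"

definition W_adj :: "nat \<Rightarrow> (real \<Rightarrow> complex) \<Rightarrow> complex Matrix.vec" where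
  "W_adj N f = Matrix.vec N (\<lambda>i. L2_inner f (step N (Suc i)))"

definition rand_mat :: "(nat \<Rightarrow> nat \<Rightarrow> nat \<Rightarrow> 'w \<Rightarrow> complex) \<Rightarrow> nat \<Rightarrow> 'w \<Rightarrow> complex Matrix.mat" where
  "rand_mat X N \<omega> = Matrix.mat N N (\<lambda>(i, j). X N (Suc i) (Suc j) \<omega> / of_nat N)"

end

theory Submission
  imports Defs
begin

text \<open>
  With \<open>n = a\<^sub>N\<close>, the bilinear form \<open>\<langle>W\<^sub>n X\<^sub>n W\<^sub>n\<^sup>* u, v\<rangle>\<close> is
  \<open>\<Sum>\<^sub>j\<^sub>\<le>\<^sub>i X\<^sub>i\<^sub>j p\<^sub>j q\<^sub>i\<close>, where \<open>p\<^sub>j\<close> and \<open>q\<^sub>i\<close> are the integrals of \<open>u\<close> and of the conjugate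
  of \<open>v\<close> over the grid cells of length \<open>1/n\<close>. Summing the \<open>p\<^sub>j\<close> over \<open>j \<le> i\<close> turns its mean into
  \<open>\<mu>\<^sub>n\<close> times the inner product of \<open>v\<close> with the function \<open>x \<mapsto> V u (\<lceil>n x\<rceil> / n)\<close>, which tends to
  \<open>V u\<close> boundedly because \<open>V u\<close> is continuous. By orthogonality of independent centred variables and by
  Bessel's inequality, the variance is at most \<open>\<sigma>\<^sub>n\<^sup>2 \<parallel>u\<parallel>\<^sup>2 \<parallel>v\<parallel>\<^sup>2 / n\<^sup>2\<close>. Dividing the squared
  fluctuations by \<open>(k(N) \<sigma>\<^sub>n / n)\<^sup>2 \<longlonglongrightarrow> 0\<close> leaves random variables whose expectations are dominated
  by a multiple of \<open>1 / k(N)\<^sup>2\<close>; hence they are almost surely summable, and the fluctuations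
  tend to \<open>0\<close> almost surely.
\<close>


section \<open>The bilinear form in terms of cell integrals\<close>

text \<open>The coefficient against \<open>step n i\<close> without its factor
  \<open>sqrt n\<close>: in the bilinear form two such factors cancel the \<open>1/n\<close> of the
  matrix. The cells are closed, so neighbours share an endpoint; all identities over cells therefore
  hold off a null set.\<close>

definition cell_integral :: "nat \<Rightarrow> nat \<Rightarrow> (real \<Rightarrow> complex) \<Rightarrow> complex" where
  "cell_integral n i f =
     (\<integral>x. indicator {(real i - 1) / real n..real i / real n} x * f x \<partial>lebesgue_on {0..1})"

lemma finite_measure_lebesgue_on_unit: "finite_measure (lebesgue_on {0..1::real})"
  by (rule finite_measureI) (simp add: emeasure_restrict_space)

lemma indicator_measurable_lebesgue_on:
  "(indicator {s..t::real} :: real \<Rightarrow> 'a::real_normed_algebra_1) \<in> borel_measurable (lebesgue_on {0..1})"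
  by (intro measurable_restrict_space1 borel_measurable_indicator) simp

text \<open>On a finite measure space \<open>1 + |u|^2\<close> is an integrable majorant of
  \<open>|u|\<close>.\<close>

lemma L2_01_integrable:
  assumes "u \<in> L2_01"
  shows "integrable (lebesgue_on {0..1}) u"
proof (rule Bochner_Integration.integrable_bound)
  interpret finite_measure "lebesgue_on {0..1::real}" by (rule finite_measure_lebesgue_on_unit)
  show "integrable (lebesgue_on {0..1}) (\<lambda>x. 1 + (norm (u x))\<^sup>2)"
    using assms by (auto simp: L2_01_def)
  \<comment> \<open>Expanding \<open>(t - 1/2)^2 \<ge> 0\<close> gives
    \<open>t \<le> t^2 + 1/4\<close>.\<close>
  have "norm (u x) \<le> 1 + (norm (u x))\<^sup>2" for x
    using sum_squares_ge_zero[of "norm (u x) - 1/2" 0] by (simp add: power2_eq_square algebra_simps)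
  then show "AE x in lebesgue_on {0..1}. norm (u x) \<le> norm (1 + (norm (u x))\<^sup>2)"
    by (intro AE_I2) (smt (verit) real_norm_def)
qed (use assms in \<open>auto simp: L2_01_def\<close>)

lemma integrable_indicator_lebesgue_on:
  fixes f :: "real \<Rightarrow> 'a::{real_normed_algebra_1,banach,second_countable_topology}"
  assumes "integrable (lebesgue_on {0..1}) f"
  shows "integrable (lebesgue_on {0..1}) (\<lambda>x. indicator {s..t} x * f x)"
proof (rule Bochner_Integration.integrable_bound[OF assms])
  show "(\<lambda>x. indicator {s..t} x * f x) \<in> borel_measurable (lebesgue_on {0..1})"
    using assms by (intro borel_measurable_times indicator_measurable_lebesgue_on) auto
qed (auto simp: indicator_def)

lemma L2_inner_step_right: "L2_inner u (step n j) = sqrt (real n) * cell_integral n j u"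
proof -
  have "u x * cnj (step n j x) =
      complex_of_real (sqrt (real n)) * (indicator {(real j - 1) / real n..real j / real n} x * u x)" for x
    by (simp add: step_def indicator_def)
  then show ?thesis by (simp only: L2_inner_def cell_integral_def integral_mult_right_zero)
qed

lemma L2_inner_step_left: "L2_inner (step n i) v = sqrt (real n) * cell_integral n i (\<lambda>x. cnj (v x))"
  by (simp add: L2_inner_def cell_integral_def step_def mult.assoc)

lemma L2_inner_W:
  assumes "v \<in> L2_01"
  shows "L2_inner (W n c) v = (\<Sum>i<n. vec_index c i * L2_inner (step n (Suc i)) v)"
proof -
  have "integrable (lebesgue_on {0..1}) (\<lambda>x. step n i x * cnj (v x))" for i
    using integrable_indicator_lebesgue_on[of "\<lambda>x. cnj (v x)"] L2_01_integrable[OF assms]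
    by (simp add: step_def mult.assoc)
  then show ?thesis
    by (simp add: L2_inner_def W_def sum_distrib_right mult.assoc Bochner_Integration.integral_sum)
qed

lemma bilinear_form_eq:
  assumes "v \<in> L2_01" "0 < n"
  shows "L2_inner (W n (rand_mat X n \<omega> *\<^sub>v W_adj n u)) v =
    (\<Sum>i=1..n. \<Sum>j=1..n. X n i j \<omega> * (cell_integral n j u * cell_integral n i (\<lambda>x. cnj (v x))))"
proof -
  have sq: "complex_of_real (sqrt (real n)) * complex_of_real (sqrt (real n)) = of_nat n"
    by (simp flip: of_real_mult)
  have scale: "x / of_nat n * (complex_of_real (sqrt (real n)) * y) * (complex_of_real (sqrt (real n)) * z)
      = x * (y * z)" for x y z :: complex
  proof -
    have "x / of_nat n * (complex_of_real (sqrt (real n)) * y) * (complex_of_real (sqrt (real n)) * z)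
      = x / of_nat n * (complex_of_real (sqrt (real n)) * complex_of_real (sqrt (real n))) * (y * z)"
      by (simp only: ac_simps)
    then show ?thesis using assms(2) by (simp add: sq)
  qed
  have "L2_inner (W n (rand_mat X n \<omega> *\<^sub>v W_adj n u)) v =
    (\<Sum>i<n. (\<Sum>j<n. X n (Suc i) (Suc j) \<omega> / of_nat n * L2_inner u (step n (Suc j)))
       * L2_inner (step n (Suc i)) v)"
    by (simp add: L2_inner_W[OF assms(1)] rand_mat_def W_adj_def scalar_prod_def atLeast0LessThan)
  also have "\<dots> = (\<Sum>i<n. \<Sum>j<n. X n (Suc i) (Suc j) \<omega> *
      (cell_integral n (Suc j) u * cell_integral n (Suc i) (\<lambda>x. cnj (v x))))"
    using scale by (simp only: sum_distrib_right L2_inner_step_left L2_inner_step_right)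
  finally show ?thesis
    by (simp add: sum.atLeast1_atMost_eq)
qed

section \<open>Grid cells and partial sums of cell integrals\<close>

text \<open>Grid points are rational, so one null set serves all grids at once. Off it, every point
  lies in exactly one cell of each grid.\<close>

lemma AE_not_grid: "AE x in lebesgue_on {0..1}. x \<in> {0..1::real} \<and> (\<forall>i::nat. \<forall>n::nat. 0 < n \<longrightarrow> real n * x \<noteq> real i)"
proof -
  have "AE x in lebesgue. x \<notin> (\<rat>::real set)"
    using countable_imp_null_set_lborel[OF countable_rat]
    by (intro AE_not_in null_sets_completionI)
  then have "AE x in lebesgue_on {0..1}. x \<in> {0..1::real} \<and> x \<notin> \<rat>"
    by (auto simp: AE_restrict_space_iff)
  then show ?thesis
  proof eventually_elim
    case (elim x)
    have "x = real i / real n" if "real n * x = real i" "0 < n" for i n :: nat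
      using that by (simp add: field_simps)
    then show ?case using elim by (metis Rats_divide Rats_of_nat)
  qed
qed

text \<open>Off the grid, the cell containing \<open>x\<close> has number
  \<open>\<lceil>n x\<rceil>\<close>. In this form a sum over cells collapses to a single term by
  \<open>sum.delta\<close>.\<close>

lemma indicator_cell:
  assumes "0 < n" "1 \<le> j" "0 \<le> x" "\<And>i. real n * x \<noteq> real i"
  shows "indicator {(real j - 1) / real n..real j / real n} x = (if j = nat \<lceil>real n * x\<rceil> then 1 else 0)"
proof -
  have "x \<in> {(real j - 1) / real n..real j / real n} \<longleftrightarrow> real j - 1 \<le> real n * x \<and> real n * x \<le> real j"
    using assms(1) by (auto simp: field_simps)
  \<comment> \<open>Since \<open>1 \<le> j\<close>, the left endpoint \<open>j - 1\<close> is a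
    natural number and is excluded as a grid point.\<close>
  also have "\<dots> \<longleftrightarrow> real j - 1 < real n * x \<and> real n * x \<le> real j"
    using assms(4)[of "j - 1"] assms(2) by (auto simp: of_nat_diff)
  also have "\<dots> \<longleftrightarrow> \<lceil>real n * x\<rceil> = int j"
    by (simp add: ceiling_eq_iff)
  also have "\<dots> \<longleftrightarrow> j = nat \<lceil>real n * x\<rceil>"
    using assms(2) by auto
  finally show ?thesis by (simp add: indicator_def)
qed

lemma nat_ceiling_bounds:
  assumes "x \<in> {0..1}" "0 < n" "\<And>i. real n * x \<noteq> real i"
  shows "1 \<le> nat \<lceil>real n * x\<rceil>" "nat \<lceil>real n * x\<rceil> \<le> n"
proof -
  have "x \<noteq> 0" using assms(3)[of 0] by auto
  then have "0 < real n * x" using assms(1,2) by simp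
  then show "1 \<le> nat \<lceil>real n * x\<rceil>" by linarith
  have "real n * x \<le> real n" using assms(1) mult_left_mono[of x 1 "real n"] by simp
  then show "nat \<lceil>real n * x\<rceil> \<le> n" by (simp add: ceiling_le_iff nat_le_iff)
qed

text \<open>Moves the variable domain into an indicator, so that all values of \<open>t\<close> are
  treated over the same measure space.\<close>

lemma volterra_eq:
  assumes "t \<le> 1"
  shows "volterra u t = (\<integral>x. indicator {0..t} x * u x \<partial>lebesgue_on {0..1})"
proof -
  have "indicator {0..1} x *\<^sub>R (indicator {0..t} x * u x) = indicator {0..t} x *\<^sub>R u x" for x
    using assms by (auto simp: indicator_def)
  then show ?thesis by (simp add: volterra_def integral_restrict_space)
qed

text \<open>On \<open>[0,1]\<close> the Lebesgue integral agrees with the gauge integral, whose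
  indefinite integral is continuous.\<close>

lemma continuous_on_volterra:
  assumes "integrable (lebesgue_on {0..1}) u"
  shows "continuous_on {0..1} (volterra u)"
proof -
  have eq: "volterra u t = integral {0..t} u" if "t \<in> {0..1}" for t
  proof -
    have "{0..t} \<inter> {0..1} = {0..t}" using that by auto
    then have "integrable (lebesgue_on {0..t}) u"
      using integrable_subinterval[OF assms] that by auto
    then show ?thesis unfolding volterra_def by (rule lebesgue_integral_eq_integral) auto
  qed
  have "continuous_on {0..1} (\<lambda>t. integral {0..t} u)"
    by (intro indefinite_integral_continuous_1 integrable_on_lebesgue_on[OF assms]) auto
  then show ?thesis by (subst continuous_on_cong[OF refl eq])
qed

text \<open>The first \<open>i\<close> cells tile \<open>[0, i/n]\<close> up to shared endpoints.
  This is where the triangular shape of the matrix produces the Volterra operator.\<close>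

lemma sum_cell_integral:
  assumes u: "integrable (lebesgue_on {0..1}) u" and n: "0 < n" "i \<le> n"
  shows "(\<Sum>j=1..i. cell_integral n j u) = volterra u (real i / real n)"
proof -
  note int = integrable_indicator_lebesgue_on[OF u]
  have "(\<Sum>j=1..i. cell_integral n j u) = (\<integral>x. (\<Sum>j=1..i. indicator {(real j - 1) / real n..real j / real n} x * u x) \<partial>lebesgue_on {0..1})"
    unfolding cell_integral_def using int by (intro Bochner_Integration.integral_sum[symmetric]) auto
  also have "\<dots> = (\<integral>x. indicator {0..real i / real n} x * u x \<partial>lebesgue_on {0..1})"
  proof (rule integral_cong_AE)
    show "AE x in lebesgue_on {0..1}. (\<Sum>j=1..i. indicator {(real j - 1) / real n..real j / real n} x * u x)
        = indicator {0..real i / real n} x * u x"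
      using AE_not_grid
    proof eventually_elim
      case (elim x)
      then have g: "\<And>i. real n * x \<noteq> real i" and x: "0 \<le> x" "x \<in> {0..1}" using n by auto
      have "(\<Sum>j=1..i. indicator {(real j - 1) / real n..real j / real n} x * u x)
          = (\<Sum>j=1..i. if j = nat \<lceil>real n * x\<rceil> then u x else 0)"
        using indicator_cell[OF n(1) _ x(1) g, where 'a=complex] by (intro sum.cong) auto
      also have "\<dots> = (if nat \<lceil>real n * x\<rceil> \<le> i then u x else 0)"
        using nat_ceiling_bounds[OF x(2) n(1) g] by (simp add: sum.delta)
      also have "nat \<lceil>real n * x\<rceil> \<le> i \<longleftrightarrow> x \<le> real i / real n"
        using n(1) by (simp add: nat_le_iff ceiling_le_iff field_simps)
      finally show ?case using x(1) by (simp add: indicator_def)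
    qed
    show "(\<lambda>x. \<Sum>j=1..i. indicator {(real j - 1) / real n..real j / real n} x * u x) \<in> borel_measurable (lebesgue_on {0..1})"
      by (intro borel_measurable_sum borel_measurable_integrable int)
    show "(\<lambda>x. indicator {0..real i / real n} x * u x) \<in> borel_measurable (lebesgue_on {0..1})"
      by (intro borel_measurable_integrable int)
  qed
  also have "\<dots> = volterra u (real i / real n)"
    using n by (simp add: volterra_eq)
  finally show ?thesis .
qed

lemma ceiling_grid_tendsto:
  fixes x :: real
  assumes "0 \<le> x"
  shows "(\<lambda>n. real (nat \<lceil>real n * x\<rceil>) / real n) \<longlonglongrightarrow> x"
proof (rule tendsto_sandwich)
  show "\<forall>\<^sub>F n in sequentially. x \<le> real (nat \<lceil>real n * x\<rceil>) / real n"
    using eventually_gt_at_top[of 0]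
  proof eventually_elim
    case (elim n)
    have "real n * x \<le> real (nat \<lceil>real n * x\<rceil>)" by linarith
    then show ?case using elim by (simp add: field_simps)
  qed
  show "\<forall>\<^sub>F n in sequentially. real (nat \<lceil>real n * x\<rceil>) / real n \<le> x + 1 / real n"
    using eventually_gt_at_top[of 0]
  proof eventually_elim
    case (elim n)
    have "0 \<le> real n * x" using assms by simp
    then have "real (nat \<lceil>real n * x\<rceil>) \<le> real n * x + 1" by linarith
    then show ?case using elim by (simp add: field_simps)
  qed
  show "(\<lambda>n. x + 1 / real n) \<longlonglongrightarrow> x"
    using tendsto_add[OF tendsto_const lim_1_over_n, of x] by simp
qed auto

section \<open>Convergence of the deterministic triangular sums\<close>

text \<open>The inner sum over \<open>j\<close> is \<open>V u (i/n)\<close>, so the whole sum is the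
  integral of a function that is almost everywhere
  \<open>V u (\<lceil>n x\<rceil> / n) * cnj (v x)\<close>. Dominated convergence applies with
  majorant \<open>B * |v|\<close>, where \<open>B\<close> bounds \<open>V u\<close> on
  \<open>[0,1]\<close>.\<close>

lemma triangular_sum_tendsto:
  assumes u: "u \<in> L2_01" and v: "v \<in> L2_01"
  shows "(\<lambda>n. \<Sum>i=1..n. \<Sum>j=1..i. cell_integral n j u * cell_integral n i (\<lambda>x. cnj (v x)))
    \<longlonglongrightarrow> L2_inner (volterra u) v"
proof -
  let ?L = "lebesgue_on {0..1::real}"
  let ?I = "\<lambda>n i. indicator {(real i - 1) / real n..real i / real n} :: real \<Rightarrow> complex"
  have intu: "integrable ?L u" and intv: "integrable ?L (\<lambda>x. cnj (v x))"
    using L2_01_integrable[OF u] L2_01_integrable[OF v] by auto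
  note cont = continuous_on_volterra[OF intu]
  have "bounded (volterra u ` {0..1})"
    by (intro compact_imp_bounded compact_continuous_image cont) simp
  then obtain B where B: "\<And>t. t \<in> {0..1} \<Longrightarrow> norm (volterra u t) \<le> B"
    by (meson bounded_iff imageI)
  have B0: "0 \<le> B" using B[of 0] by (meson norm_ge_zero order_trans atLeastAtMost_iff order_refl zero_le_one)
  \<comment> \<open>The integrand is kept as a finite sum over cells, so that measurability and the
    value of its integral follow term by term.\<close>
  define s where "s = (\<lambda>n x. \<Sum>i=1..n. volterra u (real i / real n) * (?I n i x * cnj (v x)))"
  have int_s: "integrable ?L (\<lambda>x. volterra u (real i / real n) * (?I n i x * cnj (v x)))" for n i
    using integrable_indicator_lebesgue_on[OF intv] by (intro integrable_mult_right)
  have eq: "(\<Sum>i=1..n. \<Sum>j=1..i. cell_integral n j u * cell_integral n i (\<lambda>x. cnj (v x))) = integral\<^sup>L ?L (s n)" for n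
  proof -
    have "(\<Sum>i=1..n. \<Sum>j=1..i. cell_integral n j u * cell_integral n i (\<lambda>x. cnj (v x)))
        = (\<Sum>i=1..n. volterra u (real i / real n) * cell_integral n i (\<lambda>x. cnj (v x)))"
      using sum_cell_integral[OF intu] by (intro sum.cong refl) (auto simp: sum_distrib_right[symmetric])
    also have "\<dots> = integral\<^sup>L ?L (s n)"
      unfolding s_def using int_s
      by (subst Bochner_Integration.integral_sum) (auto simp: cell_integral_def)
    finally show ?thesis .
  qed
  have ratio: "real m / real n \<in> {0..1}" if "m \<le> n" for m n :: nat
    using that by (auto simp: divide_le_eq_1)
  \<comment> \<open>The quantifier over \<open>n\<close> stands inside the almost-everywhere
    statement, since pointwise convergence needs all \<open>n\<close> at the same
    \<open>x\<close>.\<close>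
  have s_eq: "AE x in ?L. x \<in> {0..1} \<and> (\<forall>n>0. nat \<lceil>real n * x\<rceil> \<le> n \<and>
      s n x = volterra u (real (nat \<lceil>real n * x\<rceil>) / real n) * cnj (v x))"
    using AE_not_grid
  proof eventually_elim
    case (elim x)
    then have x: "0 \<le> x" "x \<in> {0..1}" by auto
    have "nat \<lceil>real n * x\<rceil> \<le> n \<and> s n x = volterra u (real (nat \<lceil>real n * x\<rceil>) / real n) * cnj (v x)"
      if n: "0 < n" for n
    proof -
      have g: "\<And>i. real n * x \<noteq> real i" using elim n by auto
      note bd = nat_ceiling_bounds[OF x(2) n g]
      have "s n x = (\<Sum>i=1..n. if i = nat \<lceil>real n * x\<rceil> then volterra u (real i / real n) * cnj (v x) else 0)"
        unfolding s_def using indicator_cell[OF n _ x(1) g, where 'a=complex] by (intro sum.cong) auto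
      then show ?thesis using bd x by (simp add: sum.delta)
    qed
    then show ?case using x by blast
  qed
  have "(\<lambda>n. integral\<^sup>L ?L (s n)) \<longlonglongrightarrow> integral\<^sup>L ?L (\<lambda>x. volterra u x * cnj (v x))"
  proof (rule integral_dominated_convergence[where w="\<lambda>x. B * norm (cnj (v x))"])
    show "s n \<in> borel_measurable ?L" for n
      unfolding s_def using int_s by (intro borel_measurable_sum borel_measurable_integrable)
    have "volterra u \<in> borel_measurable ?L"
      using cont by (rule continuous_imp_measurable_on_sets_lebesgue) auto
    then show "(\<lambda>x. volterra u x * cnj (v x)) \<in> borel_measurable ?L"
      by (intro borel_measurable_times borel_measurable_integrable[OF intv])
    show "integrable ?L (\<lambda>x. B * norm (cnj (v x)))"
      using intv by (intro integrable_mult_right integrable_norm)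
    show "AE x in ?L. (\<lambda>n. s n x) \<longlonglongrightarrow> volterra u x * cnj (v x)"
      using s_eq
    proof eventually_elim
      case (elim x)
      let ?g = "\<lambda>n. real (nat \<lceil>real n * x\<rceil>) / real n"
      have ev: "\<forall>\<^sub>F n in sequentially. ?g n \<in> {0..1}"
        by (rule eventually_mono[OF eventually_gt_at_top[of 0]]) (use elim ratio in blast)
      have "(\<lambda>n. volterra u (?g n)) \<longlonglongrightarrow> volterra u x"
        by (rule continuous_on_tendsto_compose[OF cont ceiling_grid_tendsto _ ev]) (use elim in auto)
      then have "(\<lambda>n. volterra u (?g n) * cnj (v x)) \<longlonglongrightarrow> volterra u x * cnj (v x)"
        by (intro tendsto_intros)
      moreover have "\<forall>\<^sub>F n in sequentially. volterra u (?g n) * cnj (v x) = s n x"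
        by (rule eventually_mono[OF eventually_gt_at_top[of 0]]) (use elim in auto)
      ultimately show ?case by (rule Lim_transform_eventually)
    qed
    show "AE x in ?L. norm (s n x) \<le> B * norm (cnj (v x))" for n
    proof (cases "n = 0")
      case True
      then show ?thesis using B0 by (auto simp: s_def)
    next
      case False
      show ?thesis using s_eq
      proof eventually_elim
        case (elim x)
        then have "norm (volterra u (real (nat \<lceil>real n * x\<rceil>) / real n)) \<le> B"
          using False by (intro B ratio) auto
        then show ?case using elim False by (simp add: norm_mult mult_right_mono)
      qed
    qed
  qed
  then show ?thesis by (simp only: eq L2_inner_def)
qed

section \<open>Bessel's inequality on the grid\<close>

text \<open>Bessel's inequality for the functions \<open>step n j\<close>; the denominator
  \<open>n\<close> comes from the factors \<open>sqrt n\<close> left out of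
  \<open>cell_integral\<close>. It follows from Cauchy-Schwarz on each cell and the almost
  disjointness of the cells.\<close>

lemma sum_cell_integral_norm_le:
  assumes u: "u \<in> L2_01" and n: "0 < n"
  shows "(\<Sum>j=1..n. (norm (cell_integral n j u))\<^sup>2) \<le> (\<integral>x. (norm (u x))\<^sup>2 \<partial>lebesgue_on {0..1}) / real n"
proof -
  let ?L = "lebesgue_on {0..1::real}"
  let ?I = "\<lambda>i. indicator {(real i - 1) / real n..real i / real n} :: real \<Rightarrow> real"
  have intu: "integrable ?L u" and intu2: "integrable ?L (\<lambda>x. (norm (u x))\<^sup>2)"
    using L2_01_integrable[OF u] u by (auto simp: L2_01_def)
  have int2: "integrable ?L (\<lambda>x. ?I i x * (norm (u x))\<^sup>2)" for i
    using integrable_indicator_lebesgue_on[OF intu2] .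
  have cell: "real n * (norm (cell_integral n j u))\<^sup>2 \<le> (\<integral>x. ?I j x * (norm (u x))\<^sup>2 \<partial>?L)"
    if j: "j \<in> {1..n}" for j
  proof -
    define r where "r = norm (cell_integral n j u)"
    have "0 \<le> (real j - 1) / real n" "real j / real n \<le> 1"
      using j n by auto
    then have "{(real j - 1) / real n..real j / real n} \<inter> {0..1} = {(real j - 1) / real n..real j / real n}"
      by auto
    then have len: "(\<integral>x. ?I j x \<partial>?L) = 1 / real n"
      using n j by (simp add: measure_restrict_space field_simps)
    have int1: "integrable ?L (?I j)"
      using integrable_indicator_lebesgue_on[of "\<lambda>_. 1 :: real"] finite_measure_lebesgue_on_unit
      by (simp add: finite_measure.integrable_const)
    have intn: "integrable ?L (\<lambda>x. ?I j x * norm (u x))"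
      using integrable_indicator_lebesgue_on[OF integrable_norm[OF intu]] .
    have "r \<le> (\<integral>x. norm (indicator {(real j - 1) / real n..real j / real n} x * u x) \<partial>?L)"
      unfolding r_def cell_integral_def by (rule integral_norm_bound)
    also have "\<dots> = (\<integral>x. ?I j x * norm (u x) \<partial>?L)"
      by (intro Bochner_Integration.integral_cong) (auto simp: indicator_def)
    \<comment> \<open>Cauchy--Schwarz on the cell, as \<open>2 s \<bar>u\<bar> \<le> s\<^sup>2 + \<bar>u\<bar>\<^sup>2\<close> for the optimal \<open>s = n r\<close>.\<close>
    finally have "2 * (real n * r) * r \<le> 2 * (real n * r) * (\<integral>x. ?I j x * norm (u x) \<partial>?L)"
      by (intro mult_left_mono) (auto simp: r_def)
    also have "\<dots> = (\<integral>x. 2 * (real n * r) * (?I j x * norm (u x)) \<partial>?L)"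
      by simp
    also have "\<dots> \<le> (\<integral>x. (real n * r)\<^sup>2 * ?I j x + ?I j x * (norm (u x))\<^sup>2 \<partial>?L)"
    proof (rule integral_mono)
      fix x
      show "2 * (real n * r) * (?I j x * norm (u x)) \<le> (real n * r)\<^sup>2 * ?I j x + ?I j x * (norm (u x))\<^sup>2"
        using sum_squares_bound[of "real n * r" "norm (u x)"] by (simp add: indicator_def)
    qed (use int1 int2 intn in auto)
    also have "\<dots> = (\<integral>x. (real n * r)\<^sup>2 * ?I j x \<partial>?L) + (\<integral>x. ?I j x * (norm (u x))\<^sup>2 \<partial>?L)"
      using int1 int2 by (intro Bochner_Integration.integral_add) auto
    also have "\<dots> = (real n * r)\<^sup>2 * (1 / real n) + (\<integral>x. ?I j x * (norm (u x))\<^sup>2 \<partial>?L)"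
      by (simp only: integral_mult_right_zero len)
    \<comment> \<open>The term \<open>(n r)^2 / n = n r^2\<close> is absorbed by
      \<open>2 n r^2\<close> on the left, which leaves \<open>n r^2\<close>.\<close>
    finally show ?thesis
      using n by (simp add: r_def[symmetric] power2_eq_square mult.commute mult.left_commute)
  qed
  have "real n * (\<Sum>j=1..n. (norm (cell_integral n j u))\<^sup>2) \<le> (\<Sum>j=1..n. \<integral>x. ?I j x * (norm (u x))\<^sup>2 \<partial>?L)"
    unfolding sum_distrib_left by (intro sum_mono cell)
  also have "\<dots> = (\<integral>x. (\<Sum>j=1..n. ?I j x * (norm (u x))\<^sup>2) \<partial>?L)"
    using int2 by (intro Bochner_Integration.integral_sum[symmetric])
  also have "\<dots> \<le> (\<integral>x. (norm (u x))\<^sup>2 \<partial>?L)"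
  proof (rule integral_mono_AE)
    show "AE x in ?L. (\<Sum>j=1..n. ?I j x * (norm (u x))\<^sup>2) \<le> (norm (u x))\<^sup>2"
      using AE_not_grid
    proof eventually_elim
      case (elim x)
      then have g: "\<And>i. real n * x \<noteq> real i" and x: "0 \<le> x" using n by auto
      have "(\<Sum>j=1..n. ?I j x * (norm (u x))\<^sup>2) = (\<Sum>j=1..n. if j = nat \<lceil>real n * x\<rceil> then (norm (u x))\<^sup>2 else 0)"
        using indicator_cell[OF n _ x g, where 'a=real] by (intro sum.cong) auto
      then show ?case by (simp add: sum.delta)
    qed
  qed (intro Bochner_Integration.integrable_sum int2 intu2)+
  finally show ?thesis using n by (simp add: field_simps)
qed



section \<open>Second moments of sums of independent centred variables\<close>

text \<open>Independence makes the product integrable and its expectation factor; one centred factor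
  then makes it vanish.\<close>

lemma (in prob_space) indep_centered_orthogonal:
  fixes Z :: "'i \<Rightarrow> 'a \<Rightarrow> complex"
  assumes ind: "indep_vars (\<lambda>_. borel) Z I" and pq: "p \<in> I" "q \<in> I" "p \<noteq> q"
    and int: "integrable M (Z p)" "integrable M (Z q)" and cent: "expectation (Z p) = 0"
  shows "integrable M (\<lambda>\<omega>. Z p \<omega> * cnj (Z q \<omega>))" "expectation (\<lambda>\<omega>. Z p \<omega> * cnj (Z q \<omega>)) = 0"
proof -
  \<comment> \<open>Conjugating only the member with index \<open>q\<close> turns the mixed product
    into a plain product over the index set \<open>{p, q}\<close>.\<close>
  define Y where "Y = (\<lambda>i \<omega>. if i = q then cnj (Z i \<omega>) else Z i \<omega>)"
  have "indep_vars (\<lambda>_. borel) Z {p, q}"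
    using indep_vars_subset[OF ind] pq by auto
  then have ind': "indep_vars (\<lambda>_. borel) (\<lambda>i \<omega>. (if i = q then cnj else id) (Z i \<omega>)) {p, q}"
    by (rule indep_vars_compose2) (auto intro!: borel_measurable_continuous_onI continuous_intros)
  have Y_eq: "(\<lambda>i \<omega>. (if i = q then cnj else id) (Z i \<omega>)) = Y"
    by (auto simp: Y_def fun_eq_iff)
  have int': "integrable M (Y i)" if "i \<in> {p, q}" for i
    using that int pq(3) by (auto simp: Y_def)
  show "integrable M (\<lambda>\<omega>. Z p \<omega> * cnj (Z q \<omega>))"
    using indep_vars_integrable[OF _ ind'[unfolded Y_eq] int'] pq(3) by (simp add: Y_def)
  show "expectation (\<lambda>\<omega>. Z p \<omega> * cnj (Z q \<omega>)) = 0"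
    using indep_vars_lebesgue_integral[OF _ ind'[unfolded Y_eq] int'] pq(3) cent by (simp add: Y_def)
qed

text \<open>The Bienayme identity: expand \<open>|S|^2 = S * cnj S\<close> as a double sum, whose
  off-diagonal terms have expectation zero. The expansion lives in the complex numbers; the results
  are carried back through \<open>Re\<close> and the injectivity of \<open>of_real\<close>.\<close>

lemma (in prob_space) second_moment_indep_sum:
  fixes Z :: "'i \<Rightarrow> 'a \<Rightarrow> complex"
  assumes fin: "finite I" and ind: "indep_vars (\<lambda>_. borel) Z I"
    and int: "\<And>p. p \<in> I \<Longrightarrow> integrable M (Z p)"
    and cent: "\<And>p. p \<in> I \<Longrightarrow> expectation (Z p) = 0"
    and int2: "\<And>p. p \<in> I \<Longrightarrow> integrable M (\<lambda>\<omega>. (norm (Z p \<omega>))\<^sup>2)"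
  shows "integrable M (\<lambda>\<omega>. (norm (\<Sum>p\<in>I. Z p \<omega>))\<^sup>2)"
    and "expectation (\<lambda>\<omega>. (norm (\<Sum>p\<in>I. Z p \<omega>))\<^sup>2) = (\<Sum>p\<in>I. expectation (\<lambda>\<omega>. (norm (Z p \<omega>))\<^sup>2))"
proof -
  have sq: "complex_of_real ((norm (\<Sum>p\<in>I. Z p \<omega>))\<^sup>2) = (\<Sum>p\<in>I. \<Sum>q\<in>I. Z p \<omega> * cnj (Z q \<omega>))" for \<omega>
    by (simp only: complex_norm_square cnj_sum sum_product)
  have diag: "Z p \<omega> * cnj (Z p \<omega>) = complex_of_real ((norm (Z p \<omega>))\<^sup>2)" for p \<omega>
    by (simp only: complex_norm_square)
  have prod: "integrable M (\<lambda>\<omega>. Z p \<omega> * cnj (Z q \<omega>))" if "p \<in> I" "q \<in> I" for p q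
  proof (cases "p = q")
    case True
    then show ?thesis using int2[OF that(1)] by (simp only: diag integrable_of_real)
  next
    case False
    then show ?thesis using indep_centered_orthogonal(1)[OF ind that False int int cent] that by blast
  qed
  have "integrable M (\<lambda>\<omega>. complex_of_real ((norm (\<Sum>p\<in>I. Z p \<omega>))\<^sup>2))"
    unfolding sq using prod by (intro Bochner_Integration.integrable_sum) auto
  then have "integrable M (\<lambda>\<omega>. Re (complex_of_real ((norm (\<Sum>p\<in>I. Z p \<omega>))\<^sup>2)))"
    by (rule integrable_Re)
  then show "integrable M (\<lambda>\<omega>. (norm (\<Sum>p\<in>I. Z p \<omega>))\<^sup>2)" by (simp only: Re_complex_of_real)
  have "complex_of_real (expectation (\<lambda>\<omega>. (norm (\<Sum>p\<in>I. Z p \<omega>))\<^sup>2))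
      = expectation (\<lambda>\<omega>. \<Sum>p\<in>I. \<Sum>q\<in>I. Z p \<omega> * cnj (Z q \<omega>))"
    by (simp only: integral_complex_of_real[symmetric] sq)
  also have "\<dots> = (\<Sum>p\<in>I. \<Sum>q\<in>I. expectation (\<lambda>\<omega>. Z p \<omega> * cnj (Z q \<omega>)))"
    using prod by (simp add: Bochner_Integration.integral_sum)
  also have "\<dots> = (\<Sum>p\<in>I. \<Sum>q\<in>I. if q = p then expectation (\<lambda>\<omega>. Z p \<omega> * cnj (Z p \<omega>)) else 0)"
    using indep_centered_orthogonal(2)[OF ind _ _ _ int int cent] by (intro sum.cong) auto
  also have "\<dots> = (\<Sum>p\<in>I. expectation (\<lambda>\<omega>. Z p \<omega> * cnj (Z p \<omega>)))"
    using fin by (simp add: sum.delta)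
  also have "\<dots> = complex_of_real (\<Sum>p\<in>I. expectation (\<lambda>\<omega>. (norm (Z p \<omega>))\<^sup>2))"
    by (simp only: diag integral_complex_of_real of_real_sum)
  finally show "expectation (\<lambda>\<omega>. (norm (\<Sum>p\<in>I. Z p \<omega>))\<^sup>2) = (\<Sum>p\<in>I. expectation (\<lambda>\<omega>. (norm (Z p \<omega>))\<^sup>2))"
    by (simp only: of_real_eq_iff)
qed

section \<open>Almost sure convergence from summable second moments\<close>

text \<open>By monotone convergence the series has finite integral, so it converges almost
  everywhere, and its terms tend to zero there.\<close>

lemma AE_tendsto_0_if_summable_integrals:
  fixes f :: "nat \<Rightarrow> 'a \<Rightarrow> real"
  assumes int: "\<And>n. integrable M (f n)" and nn: "\<And>n x. 0 \<le> f n x"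
    and sum: "(\<Sum>n. ennreal (integral\<^sup>L M (f n))) < \<infinity>"
  shows "AE x in M. (\<lambda>n. f n x) \<longlonglongrightarrow> 0"
proof -
  have [measurable]: "f n \<in> borel_measurable M" for n using int by auto
  have "(\<integral>\<^sup>+ x. (\<Sum>n. ennreal (f n x)) \<partial>M) \<noteq> \<infinity>"
    using sum nn int by (subst nn_integral_suminf) (simp_all add: nn_integral_eq_integral)
  then have "AE x in M. (\<Sum>n. ennreal (f n x)) \<noteq> \<infinity>"
    by (intro nn_integral_PInf_AE) auto
  then show ?thesis
  proof eventually_elim
    case (elim x)
    then have "summable (\<lambda>n. f n x)"
      using nn by (intro summable_suminf_not_top) auto
    then show ?case by (rule summable_LIMSEQ_zero)
  qed
qed

text \<open>Write \<open>|f n|^2 = g n * (k n * r n)^2\<close>. The expectation of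
  \<open>g n\<close> is at most \<open>C / (k n)^2\<close>, which is summable, so \<open>g n\<close>
  tends to zero almost everywhere, while the other factor tends to zero by assumption.\<close>

lemma AE_tendsto_0_if_second_moments_le:
  fixes f :: "nat \<Rightarrow> 'a \<Rightarrow> complex" and r k :: "nat \<Rightarrow> real"
  assumes int: "\<And>n. integrable M (\<lambda>x. (norm (f n x))\<^sup>2)"
    and bound: "\<And>n. (\<integral>x. (norm (f n x))\<^sup>2 \<partial>M) \<le> C * (r n)\<^sup>2"
    and C: "0 \<le> C" and k: "\<And>n. 0 \<le> k n"
    and kr: "(\<lambda>n. k n * r n) \<longlonglongrightarrow> 0"
    and summ: "(\<Sum>n. 1 / (ennreal (k n))\<^sup>2) < \<infinity>"
  shows "AE x in M. (\<lambda>n. f n x) \<longlonglongrightarrow> 0"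
proof -
  \<comment> \<open>In \<open>ennreal\<close>, \<open>1 / 0 = \<infinity>\<close>, so a single
    vanishing \<open>k n\<close> would make the series infinite.\<close>
  have k_pos: "0 < k n" for n
  proof (rule ccontr)
    assume "\<not> 0 < k n"
    with k[of n] have "1 / (ennreal (k n))\<^sup>2 = \<infinity>" by simp
    moreover have "1 / (ennreal (k n))\<^sup>2 \<le> (\<Sum>n. 1 / (ennreal (k n))\<^sup>2)"
      using sum_le_suminf[of "\<lambda>n. 1 / (ennreal (k n))\<^sup>2" "{n}"] by simp
    ultimately show False using summ by (simp add: top_unique)
  qed
  \<comment> \<open>Where \<open>r n = 0\<close> the division yields \<open>g n = 0\<close>, but then \<open>f n\<close> vanishes almost everywhere.\<close>
  define g where "g = (\<lambda>n x. (norm (f n x))\<^sup>2 / (k n * r n)\<^sup>2)"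
  have "(\<integral>x. g n x \<partial>M) \<le> C * (1 / (k n)\<^sup>2)" for n
  proof (cases "r n = 0")
    case False
    have "(\<integral>x. g n x \<partial>M) = (\<integral>x. (norm (f n x))\<^sup>2 \<partial>M) / (k n * r n)\<^sup>2"
      by (simp add: g_def)
    also have "\<dots> \<le> C * (r n)\<^sup>2 / (k n * r n)\<^sup>2"
      by (intro divide_right_mono bound) auto
    also have "\<dots> = C * (1 / (k n)\<^sup>2)" using False by (simp add: power_mult_distrib)
    finally show ?thesis .
  qed (use C in \<open>simp add: g_def\<close>)
  moreover have "ennreal (C * (1 / (k n)\<^sup>2)) = ennreal C * (1 / (ennreal (k n))\<^sup>2)" for n
    using k_pos[of n] C by (subst ennreal_mult) (simp_all add: ennreal_power divide_ennreal flip: ennreal_1)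
  ultimately have le: "ennreal (\<integral>x. g n x \<partial>M) \<le> ennreal C * (1 / (ennreal (k n))\<^sup>2)" for n
    by (metis ennreal_leI)
  have "(\<Sum>n. ennreal (\<integral>x. g n x \<partial>M)) \<le> (\<Sum>n. ennreal C * (1 / (ennreal (k n))\<^sup>2))"
    by (intro suminf_le le) auto
  also have "\<dots> < \<infinity>" using summ by (simp add: ennreal_mult_less_top)
  finally have "AE x in M. (\<lambda>n. g n x) \<longlonglongrightarrow> 0"
    using int by (intro AE_tendsto_0_if_summable_integrals) (auto simp: g_def)
  moreover have "AE x in M. \<forall>n. r n = 0 \<longrightarrow> f n x = 0"
    unfolding AE_all_countable
  proof
    fix n
    show "AE x in M. r n = 0 \<longrightarrow> f n x = 0"
    proof (cases "r n = 0")
      case True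
      have "(\<integral>x. (norm (f n x))\<^sup>2 \<partial>M) = 0"
        using bound[of n] True by (intro antisym) auto
      then show ?thesis
        using integral_nonneg_eq_0_iff_AE[OF int[of n]] by simp
    qed simp
  qed
  ultimately show ?thesis
  proof eventually_elim
    case (elim x)
    have "(norm (f n x))\<^sup>2 = g n x * (k n * r n)\<^sup>2" for n
      using elim(2) k_pos[of n] by (cases "r n = 0") (auto simp: g_def)
    moreover have "(\<lambda>n. g n x * (k n * r n)\<^sup>2) \<longlonglongrightarrow> 0 * 0\<^sup>2"
      by (intro tendsto_intros elim kr)
    ultimately have "(\<lambda>n. sqrt ((norm (f n x))\<^sup>2)) \<longlonglongrightarrow> sqrt 0"
      by (intro tendsto_real_sqrt) simp
    then show ?case by (simp add: tendsto_norm_zero_iff)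
  qed
qed

section \<open>Splitting the bilinear form into mean and fluctuation\<close>

theorem theorem1p2:
  fixes M :: "'w measure"
    and X :: "nat \<Rightarrow> nat \<Rightarrow> nat \<Rightarrow> 'w \<Rightarrow> complex"
    and \<mu> :: "nat \<Rightarrow> complex" and \<sigma> :: "nat \<Rightarrow> real"
    and a :: "nat \<Rightarrow> nat" and k :: "nat \<Rightarrow> real" and \<mu>_lim :: complex
    and u v :: "real \<Rightarrow> complex"
  assumes "prob_space M"
    and indep: "\<And>N. N \<ge> 1 \<Longrightarrow>
      prob_space.indep_vars M (\<lambda>_. borel) (\<lambda>(i, j). X N i j) {(i, j). 1 \<le> j \<and> j \<le> i \<and> i \<le> N}"
    and ident: "\<And>N i j i' j'. 1 \<le> j \<Longrightarrow> j \<le> i \<Longrightarrow> i \<le> N \<Longrightarrow> 1 \<le> j' \<Longrightarrow> j' \<le> i' \<Longrightarrow> i' \<le> N \<Longrightarrow>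
      distr M borel (X N i j) = distr M borel (X N i' j')"
    and mean_finite: "\<And>N i j. 1 \<le> j \<Longrightarrow> j \<le> i \<Longrightarrow> i \<le> N \<Longrightarrow> integrable M (X N i j)"
    and mean: "\<And>N i j. 1 \<le> j \<Longrightarrow> j \<le> i \<Longrightarrow> i \<le> N \<Longrightarrow> integral\<^sup>L M (X N i j) = \<mu> N"
    and var_finite: "\<And>N i j. 1 \<le> j \<Longrightarrow> j \<le> i \<Longrightarrow> i \<le> N \<Longrightarrow>
      integrable M (\<lambda>\<omega>. (norm (X N i j \<omega> - \<mu> N))\<^sup>2)"
    and var: "\<And>N i j. 1 \<le> j \<Longrightarrow> j \<le> i \<Longrightarrow> i \<le> N \<Longrightarrow>
      integral\<^sup>L M (\<lambda>\<omega>. (norm (X N i j \<omega> - \<mu> N))\<^sup>2) = (\<sigma> N)\<^sup>2"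
    and sigma_nonneg: "\<And>N. N \<ge> 1 \<Longrightarrow> \<sigma> N \<ge> 0"
    and upper_zero: "\<And>N i j \<omega>. 1 \<le> i \<Longrightarrow> i < j \<Longrightarrow> j \<le> N \<Longrightarrow> \<omega> \<in> space M \<Longrightarrow> X N i j \<omega> = 0"
    and a_pos: "\<And>N. a N > 0" and a_incr: "strict_mono a"
    and k_nonneg: "\<And>N. N \<ge> 1 \<Longrightarrow> k N \<ge> 0"
    and k_small: "(\<lambda>N. k N * \<sigma> (a N) / real (a N)) \<longlonglongrightarrow> 0"
    and k_summable: "(\<Sum>N. 1 / (ennreal (k (Suc N)))\<^sup>2) < \<infinity>"
    and mu_conv: "(\<lambda>N. \<mu> (a N)) \<longlonglongrightarrow> \<mu>_lim"
    and "u \<in> L2_01" and "v \<in> L2_01"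
  shows "AE \<omega> in M.
      (\<lambda>N. L2_inner (W (a N) (rand_mat X (a N) \<omega> *\<^sub>v W_adj (a N) u)) v)
        \<longlonglongrightarrow> \<mu>_lim * L2_inner (volterra u) v"
proof -
  interpret prob_space M by fact
  define P where "P = (\<lambda>n::nat. SIGMA i:{1..n}. {1..i})"
  define w where "w = (\<lambda>n (i, j). cell_integral n j u * cell_integral n i (\<lambda>x. cnj (v x)))"
  define Z where "Z = (\<lambda>n (i, j) \<omega>. (X n i j \<omega> - \<mu> n) * w n (i, j))"
  \<comment> \<open>\<open>F n\<close> is the fluctuation of the bilinear form; its mean is
    \<open>\<mu> n\<close> times the sum of the weights \<open>w n p\<close>.\<close>
  define F where "F = (\<lambda>n \<omega>. \<Sum>p\<in>P n. Z n p \<omega>)"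
  define C where "C = (\<integral>x. (norm (u x))\<^sup>2 \<partial>lebesgue_on {0..1}) * (\<integral>x. (norm (v x))\<^sup>2 \<partial>lebesgue_on {0..1})"
  have P_eq: "P n = {(i, j). 1 \<le> j \<and> j \<le> i \<and> i \<le> n}" for n
    by (auto simp: P_def)
  have fin: "finite (P n)" for n by (simp add: P_def)
  have v': "(\<lambda>x. cnj (v x)) \<in> L2_01"
  proof -
    have "integrable (lebesgue_on {0..1}) (\<lambda>x. cnj (v x))"
      using L2_01_integrable[OF \<open>v \<in> L2_01\<close>] by simp
    from borel_measurable_integrable[OF this] show ?thesis
      using \<open>v \<in> L2_01\<close> by (simp add: L2_01_def)
  qed
  have decomp: "L2_inner (W n (rand_mat X n \<omega> *\<^sub>v W_adj n u)) v = F n \<omega> + \<mu> n * (\<Sum>p\<in>P n. w n p)"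
    if n: "0 < n" and \<omega>: "\<omega> \<in> space M" for n \<omega>
  proof -
    have "L2_inner (W n (rand_mat X n \<omega> *\<^sub>v W_adj n u)) v = (\<Sum>i=1..n. \<Sum>j=1..n. X n i j \<omega> * w n (i, j))"
      using bilinear_form_eq[OF \<open>v \<in> L2_01\<close> n] by (simp add: w_def)
    also have "\<dots> = (\<Sum>i=1..n. \<Sum>j=1..i. X n i j \<omega> * w n (i, j))"
      using upper_zero \<omega> by (intro sum.cong refl sum.mono_neutral_right) auto
    also have "\<dots> = (\<Sum>(i, j)\<in>P n. X n i j \<omega> * w n (i, j))"
      by (simp add: P_def sum.Sigma)
    also have "\<dots> = (\<Sum>p\<in>P n. Z n p \<omega> + \<mu> n * w n p)"
      by (intro sum.cong) (auto simp: Z_def algebra_simps)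
    finally show ?thesis by (simp add: F_def sum.distrib sum_distrib_left)
  qed
  have second_moment: "integrable M (\<lambda>\<omega>. (norm (F n \<omega>))\<^sup>2)"
      "(\<integral>\<omega>. (norm (F n \<omega>))\<^sup>2 \<partial>M) \<le> C * (\<sigma> n / real n)\<^sup>2" if n: "0 < n" for n
  proof -
    have ind: "indep_vars (\<lambda>_. borel) (Z n) (P n)"
    proof -
      have "indep_vars (\<lambda>_. borel) (\<lambda>(i, j). X n i j) (P n)"
        using indep[of n] n by (simp add: P_eq)
      then have "indep_vars (\<lambda>_. borel) (\<lambda>p \<omega>. ((case p of (i, j) \<Rightarrow> X n i j) \<omega> - \<mu> n) * w n p) (P n)"
        by (rule indep_vars_compose2) simp
      moreover have "(\<lambda>p \<omega>. ((case p of (i, j) \<Rightarrow> X n i j) \<omega> - \<mu> n) * w n p) = Z n"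
        by (auto simp: Z_def fun_eq_iff)
      ultimately show ?thesis by simp
    qed
    have int: "integrable M (Z n p)" and cent: "expectation (Z n p) = 0"
      and int2: "integrable M (\<lambda>\<omega>. (norm (Z n p \<omega>))\<^sup>2)"
      and var2: "expectation (\<lambda>\<omega>. (norm (Z n p \<omega>))\<^sup>2) = (\<sigma> n)\<^sup>2 * (norm (w n p))\<^sup>2" if p: "p \<in> P n" for p
    proof -
      obtain i j where ij: "p = (i, j)" "1 \<le> j" "j \<le> i" "i \<le> n" using p by (auto simp: P_eq)
      note [simp] = mean_finite[OF ij(2-4)] mean[OF ij(2-4)] var_finite[OF ij(2-4)] var[OF ij(2-4)]
      have Z_eq: "Z n p = (\<lambda>\<omega>. (X n i j \<omega> - \<mu> n) * w n p)"
        by (simp add: Z_def ij)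
      show "integrable M (Z n p)" "expectation (Z n p) = 0"
        by (simp_all add: Z_eq prob_space)
      show "integrable M (\<lambda>\<omega>. (norm (Z n p \<omega>))\<^sup>2)"
        "expectation (\<lambda>\<omega>. (norm (Z n p \<omega>))\<^sup>2) = (\<sigma> n)\<^sup>2 * (norm (w n p))\<^sup>2"
        by (simp_all add: Z_eq norm_mult power_mult_distrib)
    qed
    show "integrable M (\<lambda>\<omega>. (norm (F n \<omega>))\<^sup>2)"
      unfolding F_def by (rule second_moment_indep_sum(1)[OF fin ind int cent int2])
    have "(\<integral>\<omega>. (norm (F n \<omega>))\<^sup>2 \<partial>M) = (\<Sum>p\<in>P n. (\<sigma> n)\<^sup>2 * (norm (w n p))\<^sup>2)"
      unfolding F_def using second_moment_indep_sum(2)[OF fin ind int cent int2] var2 by simp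
    \<comment> \<open>Enlarging the triangle to the full square makes the sum factor into two sums,
      each bounded by Bessel's inequality with a factor \<open>1/n\<close>.\<close>
    also have "\<dots> \<le> (\<Sum>p\<in>{1..n}\<times>{1..n}. (\<sigma> n)\<^sup>2 * (norm (w n p))\<^sup>2)"
      by (intro sum_mono2) (auto simp: P_eq)
    also have "\<dots> = (\<sigma> n)\<^sup>2 * ((\<Sum>i=1..n. (norm (cell_integral n i (\<lambda>x. cnj (v x))))\<^sup>2) *
        (\<Sum>j=1..n. (norm (cell_integral n j u))\<^sup>2))"
      unfolding sum_distrib_left[symmetric] unfolding sum_product sum.cartesian_product
      by (intro arg_cong2[where f = "(*)"] refl sum.cong) (auto simp: w_def norm_mult power_mult_distrib)
    also have "\<dots> \<le> (\<sigma> n)\<^sup>2 * ((\<integral>x. (norm (cnj (v x)))\<^sup>2 \<partial>lebesgue_on {0..1}) / real n *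
        ((\<integral>x. (norm (u x))\<^sup>2 \<partial>lebesgue_on {0..1}) / real n))"
      using sum_cell_integral_norm_le[OF \<open>u \<in> L2_01\<close> n] sum_cell_integral_norm_le[OF v' n]
      by (intro mult_left_mono mult_mono) (auto intro: sum_nonneg)
    also have "\<dots> = C * (\<sigma> n / real n)\<^sup>2"
      by (simp add: C_def power2_eq_square mult.commute)
    finally show "(\<integral>\<omega>. (norm (F n \<omega>))\<^sup>2 \<partial>M) \<le> C * (\<sigma> n / real n)\<^sup>2" .
  qed
  \<comment> \<open>The hypotheses on the signs and the summability of \<open>k\<close> start at
    index 1, hence the shift; \<open>LIMSEQ_imp_Suc\<close> undoes it at the end.\<close>
  have "(\<lambda>N. k (Suc N) * (\<sigma> (a (Suc N)) / real (a (Suc N)))) \<longlonglongrightarrow> 0"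
    using LIMSEQ_Suc[OF k_small] by simp
  then have fluctuation: "AE \<omega> in M. (\<lambda>N. F (a (Suc N)) \<omega>) \<longlonglongrightarrow> 0"
    by (intro AE_tendsto_0_if_second_moments_le[where C = C and k = "\<lambda>N. k (Suc N)"
          and r = "\<lambda>N. \<sigma> (a (Suc N)) / real (a (Suc N))"]
        second_moment a_pos k_nonneg k_summable) (auto simp: C_def)
  have D: "(\<lambda>N. \<mu> (a N) * (\<Sum>p\<in>P (a N). w (a N) p)) \<longlonglongrightarrow> \<mu>_lim * L2_inner (volterra u) v"
  proof (intro tendsto_mult mu_conv)
    \<comment> \<open>The weights converge along all \<open>n\<close>; strict monotonicity of
      \<open>a\<close> passes this to the subsequence.\<close>
    have "(\<lambda>n. \<Sum>p\<in>P n. w n p) \<longlonglongrightarrow> L2_inner (volterra u) v"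
      using triangular_sum_tendsto[OF \<open>u \<in> L2_01\<close> \<open>v \<in> L2_01\<close>] by (simp add: P_def w_def sum.Sigma)
    from filterlim_compose[OF this filterlim_subseq[OF a_incr]]
    show "(\<lambda>N. \<Sum>p\<in>P (a N). w (a N) p) \<longlonglongrightarrow> L2_inner (volterra u) v" .
  qed
  show ?thesis
    using fluctuation AE_space
  proof eventually_elim
    case (elim \<omega>)
    have "(\<lambda>N. F (a N) \<omega>) \<longlonglongrightarrow> 0" using elim(1) by (rule LIMSEQ_imp_Suc)
    from tendsto_add[OF this D] show ?case
      using decomp[OF a_pos elim(2)] by simp
  qed
qed

end
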